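(* Let $X$ be a complex Banach space, $\alpha\ge1$, and $T\in\mathcal{B}(X)$ a $(C,\alpha)$-bounded operator with $\sigma(T)\cap\mathbb{T}\subseteq\{1\}$. Then $\|M_T^{\alpha-1}(n)\|=o(n)$ and $\|T^n\|=o(n^\alpha)$ as $n\to\infty$.
   Context: $\mathbb{T}$ is the unit circle in $\mathbb{C}$, $\sigma(T)$ the spectrum. For $\gamma\ge0$, $k^\gamma(n)=\frac{\Gamma(n+\gamma)}{\Gamma(\gamma)\Gamma(n+1)}$ for $\gamma>0$ and $k^0(n)=\delta_{n,0}$, $n\in\mathbb{N}_0$. For $\gamma\ge0$, $\Delta^{-\gamma}\mathcal{T}(n)=\sum_{j=0}^nk^\gamma(n-j)T^j$ and $M_T^\gamma(n)=\Delta^{-\gamma}\mathcal{T}(n)/k^{\gamma+1}(n)$ (so $M_T^0(n)=T^n$); $T$ is $(C,\gamma)$-bounded if $\sup_n\|M_T^\gamma(n)\|<\infty$. *)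

theory Defs
  imports "HOL-Analysis.Analysis" "HOL-Library.Landau_Symbols"
begin

class cnormed_vector = real_normed_vector +
  fixes scaleC :: "complex \<Rightarrow> 'a \<Rightarrow> 'a"
  assumes scaleC_add_right: "scaleC a (x + y) = scaleC a x + scaleC a y"
    and scaleC_add_left: "scaleC (a + b) x = scaleC a x + scaleC b x"
    and scaleC_scaleC: "scaleC a (scaleC b x) = scaleC (a * b) x"
    and scaleC_one: "scaleC 1 x = x"
    and scaleR_scaleC: "scaleR r x = scaleC (complex_of_real r) x"
    and norm_scaleC: "norm (scaleC a x) = cmod a * norm x"

definition clinear_op :: "('a::cnormed_vector \<Rightarrow>\<^sub>L 'a) \<Rightarrow> bool" where
  "clinear_op T \<longleftrightarrow> (\<forall>c x. blinfun_apply T (scaleC c x) = scaleC c (blinfun_apply T x))"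

definition cspectrum :: "('a::cnormed_vector \<Rightarrow>\<^sub>L 'a) \<Rightarrow> complex set" where
  "cspectrum T = {z. \<not> (\<exists>S. bounded_linear S \<and>
       (\<forall>x. S (scaleC z x - blinfun_apply T x) = x) \<and>
       (\<forall>x. scaleC z (S x) - blinfun_apply T (S x) = x))}"

primrec op_pow :: "('a::real_normed_vector \<Rightarrow>\<^sub>L 'a) \<Rightarrow> nat \<Rightarrow> ('a \<Rightarrow>\<^sub>L 'a)" where
  "op_pow T 0 = id_blinfun"
| "op_pow T (Suc n) = T o\<^sub>L op_pow T n"

definition kker :: "real \<Rightarrow> nat \<Rightarrow> real" where
  "kker \<gamma> n = (if \<gamma> = 0 then (if n = 0 then 1 else 0)
               else Gamma (real n + \<gamma>) / (Gamma \<gamma> * Gamma (real n + 1)))"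

definition cesaro_sum :: "real \<Rightarrow> ('a::real_normed_vector \<Rightarrow>\<^sub>L 'a) \<Rightarrow> nat \<Rightarrow> ('a \<Rightarrow>\<^sub>L 'a)" where
  "cesaro_sum \<gamma> T n = (\<Sum>j\<le>n. kker \<gamma> (n - j) *\<^sub>R op_pow T j)"

definition cesaro_mean :: "real \<Rightarrow> ('a::real_normed_vector \<Rightarrow>\<^sub>L 'a) \<Rightarrow> nat \<Rightarrow> ('a \<Rightarrow>\<^sub>L 'a)" where
  "cesaro_mean \<gamma> T n = (1 / kker (\<gamma> + 1) n) *\<^sub>R cesaro_sum \<gamma> T n"

definition cesaro_bounded :: "real \<Rightarrow> ('a::real_normed_vector \<Rightarrow>\<^sub>L 'a) \<Rightarrow> bool" where
  "cesaro_bounded \<gamma> T \<longleftrightarrow> (\<exists>C. \<forall>n. norm (cesaro_mean \<gamma> T n) \<le> C)"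

end

theory Submission
  imports Defs "HOL-Real_Asymp.Real_Asymp"
begin

text \<open>
  Write \<open>S n\<close> for the Cesaro sum of order \<open>\<alpha>\<close>. Then \<open>S (n + 1) = T (S n) + k\<^sup>\<alpha>(n + 1) I\<close>, where the last term is
  \<open>o(n\<^sup>\<alpha>)\<close> while \<open>S n = O(n\<^sup>\<alpha>)\<close>. After division by \<open>n\<^sup>\<alpha>\<close>, long stretches of \<open>S\<close> are therefore bounded
  almost-orbits of \<open>T\<close>. As in the Gelfand and Katznelson--Tzafriri theorems, such an orbit has spectrum
  in \<open>{1}\<close> and is almost constant, which gives \<open>S (n + 1) - S n = o(n\<^sup>\<alpha>)\<close>; this difference is
  the Cesaro sum of order \<open>\<alpha> - 1\<close>. To see it, split \<open>\<lambda> - 1 = (\<lambda> - 1) \<tau> + (\<lambda> - 1) (1 - \<tau>)\<close> on the \<open>2M\<close>-th roots of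
  unity, with \<open>\<tau>\<close> a trapezoid around \<open>1\<close>. The first part has small Wiener norm because it is localised
  at the zero of \<open>\<lambda> - 1\<close>. On the support of the second part \<open>\<lambda> - T\<close> is uniformly bounded below, which
  makes the Fejer means of the orbit small. Finally \<open>T\<^sup>n\<close> is the convolution of the sums of
  order \<open>\<alpha> - 1\<close> with the absolutely summable coefficients of \<open>(1 - z)\<close> to the power \<open>\<alpha> - 1\<close>.
\<close>

section \<open>Finite Fourier analysis\<close>

definition unity_root :: "nat \<Rightarrow> int \<Rightarrow> complex" where
  "unity_root L t = cis (2 * pi * of_int t / of_nat L)"

lemma unity_root_0 [simp]: "unity_root L 0 = 1"
  by (simp add: unity_root_def)

lemma unity_root_add: "unity_root L (s + t) = unity_root L s * unity_root L t"
  by (simp add: unity_root_def cis_mult add_divide_distrib distrib_left)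

lemma norm_unity_root [simp]: "norm (unity_root L t) = 1"
  by (simp add: unity_root_def)

lemma unity_root_power: "unity_root L (k * int j) = unity_root L k ^ j"
  by (simp add: unity_root_def Complex.DeMoivre mult_ac)

lemma unity_root_minus: "unity_root L (- t) = inverse (unity_root L t)"
  by (simp add: unity_root_def cis_inverse)

lemma unity_root_eq_1_imp_dvd:
  assumes "L > 0" "unity_root L k = 1"
  shows "int L dvd k"
proof -
  from assms(2) have "cos (2 * pi * of_int k / of_nat L) = 1"
    unfolding unity_root_def by (metis cis.simps(1) one_complex.simps(1))
  then obtain n :: int where "2 * pi * of_int k / of_nat L = of_int n * 2 * pi"
    by (auto simp: cos_one_2pi_int)
  then have "real_of_int k = of_int (n * int L)"
    using assms(1) by (simp add: field_simps)
  then have "k = n * int L"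
    by (simp only: of_int_eq_iff)
  then show ?thesis by simp
qed

lemma sum_unity_root:
  assumes "L > 0"
  shows "(\<Sum>j<L. unity_root L (k * int j)) = (if int L dvd k then of_nat L else 0)"
proof (cases "int L dvd k")
  case True
  then obtain n where n: "k = int L * n" by blast
  have "unity_root L k = 1"
    using assms cis_multiple_2pi[of "of_int n"] by (simp add: n unity_root_def mult_ac)
  then show ?thesis using True by (simp add: unity_root_power)
next
  case False
  have "unity_root L k ^ L = cis (2 * pi * of_int k)"
    using assms by (simp add: unity_root_def Complex.DeMoivre)
  also have "\<dots> = 1" by (rule cis_multiple_2pi) simp
  finally have "unity_root L k ^ L = 1" .
  moreover have "unity_root L k \<noteq> 1"
    using False unity_root_eq_1_imp_dvd[OF assms] by blast
  ultimately show ?thesis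
    using False by (simp add: unity_root_power geometric_sum)
qed

lemma sum_unity_root_centred:
  assumes "M > 0"
  shows "(\<Sum>m\<in>{- int M..<int M}. unity_root (2 * M) (k * m)) =
    (if 2 * int M dvd k then of_nat (2 * M) else 0)"
proof -
  have "(\<Sum>m\<in>{- int M..<int M}. unity_root (2 * M) (k * m)) =
     (\<Sum>j<2*M. unity_root (2 * M) (k * (int j - int M)))"
    by (rule sum.reindex_bij_witness[of _ "\<lambda>j. int j - int M" "\<lambda>m. nat (m + int M)"]) auto
  also have "\<dots> = unity_root (2 * M) (- k * int M) * (\<Sum>j<2*M. unity_root (2 * M) (k * int j))"
    by (simp add: sum_distrib_left unity_root_add[symmetric] algebra_simps)
  also have "\<dots> = (if 2 * int M dvd k then of_nat (2 * M) else 0)"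
  proof (cases "2 * int M dvd k")
    case True
    then obtain n where n: "k = 2 * int M * n" by blast
    \<comment> \<open>Centring the window costs this phase, which is 1 whenever the sum over a full
      period does not vanish.\<close>
    have "unity_root (2 * M) (- k * int M) = cis (2 * pi * of_int (- n * int M))"
      using assms by (simp add: n unity_root_def mult_ac)
    also have "\<dots> = 1" by (rule cis_multiple_2pi) simp
    finally show ?thesis using True assms sum_unity_root[of "2 * M" k] by simp
  next
    case False
    then show ?thesis using assms sum_unity_root[of "2 * M" k] by simp
  qed
  finally show ?thesis .
qed

text \<open>\<open>A\<close> lies within one period, so distinct frequencies in it stay distinct
  modulo \<open>2 * M\<close> and orthogonality leaves only the diagonal terms.\<close>

lemma finite_parseval:
  assumes "M > 0" "A \<subseteq> {- int M..<int M}"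
  shows "(\<Sum>j<2*M. (cmod (\<Sum>m\<in>A. a m * unity_root (2*M) (- m * int j)))\<^sup>2) =
    2 * real M * (\<Sum>m\<in>A. (cmod (a m))\<^sup>2)"
proof -
  let ?e = "unity_root (2*M)"
  have fin: "finite A" using assms(2) finite_subset by blast
  have "complex_of_real (\<Sum>j<2*M. (cmod (\<Sum>m\<in>A. a m * ?e (- m * int j)))\<^sup>2) =
    (\<Sum>j<2*M. (\<Sum>m\<in>A. a m * ?e (- m * int j)) * cnj (\<Sum>m\<in>A. a m * ?e (- m * int j)))"
    by (simp only: complex_norm_square[symmetric] of_real_sum)
  also have "\<dots> = (\<Sum>j<2*M. \<Sum>m\<in>A. \<Sum>l\<in>A. a m * cnj (a l) * ?e ((l - m) * int j))"
  proof (rule sum.cong[OF refl])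
    fix j
    have cnj_e: "cnj (?e t) = ?e (- t)" for t
      by (simp add: unity_root_def cis_cnj)
    show "(\<Sum>m\<in>A. a m * ?e (- m * int j)) * cnj (\<Sum>m\<in>A. a m * ?e (- m * int j)) =
      (\<Sum>m\<in>A. \<Sum>l\<in>A. a m * cnj (a l) * ?e ((l - m) * int j))"
      unfolding sum_product cnj_sum
    proof (intro sum.cong refl)
      fix m l
      have "?e ((l - m) * int j) = ?e (- m * int j) * ?e (l * int j)"
        by (simp add: unity_root_add[symmetric] algebra_simps)
      then show "a m * ?e (- m * int j) * cnj (a l * ?e (- l * int j)) =
        a m * cnj (a l) * ?e ((l - m) * int j)"
        by (simp add: cnj_e)
    qed
  qed
  also have "\<dots> = (\<Sum>m\<in>A. \<Sum>l\<in>A. a m * cnj (a l) * (\<Sum>j<2*M. ?e ((l - m) * int j)))"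
    by (subst sum.swap, rule sum.cong[OF refl], subst sum.swap) (simp add: sum_distrib_left)
  also have "\<dots> = (\<Sum>m\<in>A. \<Sum>l\<in>A. if l = m then a m * cnj (a m) * of_nat (2 * M) else 0)"
  proof (intro sum.cong refl)
    fix m l assume "m \<in> A" "l \<in> A"
    then have "m \<in> {- int M..<int M}" "l \<in> {- int M..<int M}" using assms(2) by blast+
    then have "\<bar>l - m\<bar> < 2 * int M" by auto
    then have "2 * int M dvd l - m \<longleftrightarrow> l = m"
      using dvd_imp_le_int[of "l - m" "2 * int M"] by force
    then show "a m * cnj (a l) * (\<Sum>j<2*M. ?e ((l - m) * int j)) =
       (if l = m then a m * cnj (a m) * of_nat (2 * M) else 0)"
      using assms(1) sum_unity_root[of "2*M" "l - m"] by simp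
  qed
  also have "\<dots> = complex_of_real (2 * real M * (\<Sum>m\<in>A. (cmod (a m))\<^sup>2))"
    using fin by (simp add: complex_norm_square sum_distrib_left mult_ac del: of_real_power)
  finally show ?thesis by (simp only: of_real_eq_iff)
qed

section \<open>Trapezoidal cut-off near 1 and its Wiener norm\<close>

lemma norm_unity_root_minus_1_le: "cmod (unity_root L t - 1) \<le> 2 * pi * \<bar>of_int t\<bar> / of_nat L"
proof -
  have "cmod (cis x - 1) \<le> \<bar>x\<bar>" for x
  proof (rule power2_le_imp_le)
    have "(cmod (cis x - 1))\<^sup>2 = 2 - 2 * cos x"
      unfolding cmod_power2 using sin_cos_squared_add[of x]
      by (simp add: power2_eq_square algebra_simps)
    also have "\<dots> = (2 * sin (x / 2))\<^sup>2"
      using cos_double_sin[of "x / 2"] by (simp add: power2_eq_square)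
    also have "\<dots> \<le> \<bar>x\<bar>\<^sup>2"
      using abs_sin_x_le_abs_x[of "x / 2"] by (intro abs_le_square_iff[THEN iffD1]) simp
    finally show "(cmod (cis x - 1))\<^sup>2 \<le> \<bar>x\<bar>\<^sup>2" .
  qed simp
  from this[of "2 * pi * of_int t / of_nat L"] show ?thesis
    by (simp add: unity_root_def abs_mult)
qed

text \<open>This is the normalised convolution of the indicators of [-w, w] and [-2w, 2w]: a plateau
  of height 1 up to w, then a descent to 0 beyond 3w. In this form its Fourier transform factorises
  exactly.\<close>

definition trapezoid :: "nat \<Rightarrow> int \<Rightarrow> real" where
  "trapezoid w m = real (card {s \<in> {- int w..int w}. \<bar>m - s\<bar> \<le> 2 * int w}) / (2 * real w + 1)"

lemma trapezoid_nonneg: "0 \<le> trapezoid w m"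
  by (simp add: trapezoid_def)

lemma trapezoid_le_1: "trapezoid w m \<le> 1"
proof -
  have "card {s \<in> {- int w..int w}. \<bar>m - s\<bar> \<le> 2 * int w} \<le> card {- int w..int w}"
    by (rule card_mono) auto
  then have "card {s \<in> {- int w..int w}. \<bar>m - s\<bar> \<le> 2 * int w} \<le> 2 * w + 1"
    by simp
  then have "real (card {s \<in> {- int w..int w}. \<bar>m - s\<bar> \<le> 2 * int w}) \<le> real (2 * w + 1)"
    by (simp only: of_nat_le_iff)
  then show ?thesis by (simp add: trapezoid_def)
qed

lemma trapezoid_eq_1:
  assumes "\<bar>m\<bar> \<le> int w"
  shows "trapezoid w m = 1"
proof -
  have "{s \<in> {- int w..int w}. \<bar>m - s\<bar> \<le> 2 * int w} = {- int w..int w}"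
    using assms by auto
  then show ?thesis by (simp add: trapezoid_def)
qed

text \<open>Unfolds the convolution with \<open>m = s + t\<close>. The condition
  \<open>3 * w < M\<close> keeps every \<open>s + t\<close> inside the window, so no term is cut
  off.\<close>

lemma sum_mult_trapezoid:
  fixes g :: "int \<Rightarrow> complex"
  assumes "3 * w < M"
  shows "(\<Sum>m\<in>{- int M..<int M}. g m * trapezoid w m) =
    (\<Sum>s\<in>{- int w..int w}. \<Sum>t\<in>{- 2 * int w..2 * int w}. g (s + t)) / (2 * real w + 1)"
proof -
  have "(\<Sum>m\<in>{- int M..<int M}. g m * trapezoid w m) =
    (\<Sum>m\<in>{- int M..<int M}. \<Sum>s\<in>{- int w..int w}. if \<bar>m - s\<bar> \<le> 2 * int w then g m else 0) / (2 * real w + 1)"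
  proof -
    have "(\<Sum>s\<in>{- int w..int w}. if \<bar>m - s\<bar> \<le> 2 * int w then g m else 0) =
      g m * of_nat (card {s \<in> {- int w..int w}. \<bar>m - s\<bar> \<le> 2 * int w})" for m
      by (simp add: sum.If_cases Int_def)
    then show ?thesis by (simp add: trapezoid_def sum_divide_distrib)
  qed
  also have "(\<Sum>m\<in>{- int M..<int M}. \<Sum>s\<in>{- int w..int w}. if \<bar>m - s\<bar> \<le> 2 * int w then g m else 0) =
    (\<Sum>s\<in>{- int w..int w}. \<Sum>m\<in>{- int M..<int M}. if \<bar>m - s\<bar> \<le> 2 * int w then g m else 0)"
    by (rule sum.swap)
  also have "\<dots> = (\<Sum>s\<in>{- int w..int w}. \<Sum>t\<in>{- 2 * int w..2 * int w}. g (s + t))"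
  proof (rule sum.cong[OF refl])
    fix s assume s: "s \<in> {- int w..int w}"
    have "(\<Sum>m\<in>{- int M..<int M}. if \<bar>m - s\<bar> \<le> 2 * int w then g m else 0) =
      (\<Sum>m\<in>{m \<in> {- int M..<int M}. \<bar>m - s\<bar> \<le> 2 * int w}. g m)"
      by (simp add: sum.If_cases Int_def)
    also have "\<dots> = (\<Sum>t\<in>{- 2 * int w..2 * int w}. g (s + t))"
      by (rule sum.reindex_bij_witness[of _ "\<lambda>t. s + t" "\<lambda>m. m - s"]) (use s assms in auto)
    finally show "(\<Sum>m\<in>{- int M..<int M}. if \<bar>m - s\<bar> \<le> 2 * int w then g m else 0) =
      (\<Sum>t\<in>{- 2 * int w..2 * int w}. g (s + t))" .
  qed
  finally show ?thesis .
qed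

text \<open>A weighted form of Cauchy-Schwarz: the weight \<eta> balances a factor \<open>U\<close>
  that is smaller than \<open>V\<close> by \<eta> in quadratic mean.\<close>

lemma sum_norm_mult_le:
  fixes U V :: "nat \<Rightarrow> complex"
  assumes "(\<Sum>j<n. (cmod (U j))\<^sup>2) \<le> A * \<eta>\<^sup>2" "(\<Sum>j<n. (cmod (V j))\<^sup>2) \<le> B" "\<eta> > 0"
  shows "(\<Sum>j<n. cmod (U j * V j)) \<le> (A + B) / 2 * \<eta>"
proof -
  have "cmod (U j * V j) \<le> (cmod (U j))\<^sup>2 * (1 / (2 * \<eta>)) + (cmod (V j))\<^sup>2 * (\<eta> / 2)" for j
  proof -
    have "0 \<le> (cmod (U j) - \<eta> * cmod (V j))\<^sup>2" by simp
    then show ?thesis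
      using assms(3) by (simp add: norm_mult power2_eq_square field_simps)
  qed
  then have "(\<Sum>j<n. cmod (U j * V j)) \<le>
     (\<Sum>j<n. (cmod (U j))\<^sup>2 * (1 / (2 * \<eta>)) + (cmod (V j))\<^sup>2 * (\<eta> / 2))"
    by (intro sum_mono)
  also have "\<dots> = (\<Sum>j<n. (cmod (U j))\<^sup>2) * (1 / (2 * \<eta>)) + (\<Sum>j<n. (cmod (V j))\<^sup>2) * (\<eta> / 2)"
    by (simp only: sum.distrib sum_distrib_right)
  also have "\<dots> \<le> (A * \<eta>\<^sup>2) * (1 / (2 * \<eta>)) + B * (\<eta> / 2)"
    using assms by (intro add_mono mult_right_mono) auto
  also have "\<dots> = (A + B) / 2 * \<eta>"
    using assms(3) by (simp add: power2_eq_square field_simps)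
  finally show ?thesis .
qed

text \<open>The l1 norm of a product is controlled by the l2 norms of its factors, which Parseval
  supplies. In each product below, one factor carries \<open>unity_root - 1\<close>, which is small
  on the support. The bound thus decays like 1 / q, uniformly in \<open>w\<close>.\<close>

lemma wiener_norm_trapezoid_le:
  assumes "q \<ge> 4" "w \<ge> 1" and M: "M = q * w"
  shows "(\<Sum>j<2*M. cmod (\<Sum>m\<in>{- int M..<int M}.
      (unity_root (2*M) m - 1) * trapezoid w m * unity_root (2*M) (m * (c - int j))))
    \<le> 2 * real M * (6 * pi / q)"
proof -
  let ?e = "unity_root (2*M)"
  let ?I = "{- int w..int w}" and ?J = "{- 2 * int w..2 * int w}"
  \<comment> \<open>The arc bound at distance \<open>2 * w\<close> from 0 when the period is
    \<open>2 * q * w\<close>.\<close>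
  define \<eta> where "\<eta> = 2 * pi / q"
  have \<eta>: "\<eta> > 0" using assms by (simp add: \<eta>_def)
  have "4 * w \<le> q * w" using assms(1) by simp
  then have wM: "3 * w < M" "M > 0" using assms(2) M by linarith+
  have e_le: "cmod (?e s - 1) \<le> \<eta>" if "s \<in> ?J" for s
  proof -
    have "real_of_int \<bar>s\<bar> \<le> real_of_int (2 * int w)" using that unfolding of_int_le_iff by auto
    then have "2 * pi * \<bar>of_int s\<bar> / real (2*M) \<le> 2 * pi * (2 * real w) / real (2*M)"
      by (intro divide_right_mono mult_left_mono) auto
    also have "\<dots> = \<eta>" using assms by (simp add: \<eta>_def M field_simps)
    finally show ?thesis using norm_unity_root_minus_1_le[of "2*M" s] by linarith
  qed
  have sub: "?I \<subseteq> {- int M..<int M}" "?J \<subseteq> {- int M..<int M}" using wM by auto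
  define U1 where "U1 j = (\<Sum>s\<in>?I. (?e s - 1) * ?e (s * c) * ?e (- s * int j))" for j
  define V1 where "V1 j = (\<Sum>s\<in>?J. ?e s * ?e (s * c) * ?e (- s * int j))" for j
  define U2 where "U2 j = (\<Sum>s\<in>?I. ?e (s * c) * ?e (- s * int j))" for j
  define V2 where "V2 j = (\<Sum>s\<in>?J. (?e s - 1) * ?e (s * c) * ?e (- s * int j))" for j
  have U1: "(\<Sum>j<2*M. (cmod (U1 j))\<^sup>2) \<le> (2 * real M * (2 * real w + 1)) * \<eta>\<^sup>2"
  proof -
    have "(\<Sum>j<2*M. (cmod (U1 j))\<^sup>2) = 2 * real M * (\<Sum>s\<in>?I. (cmod (?e s - 1))\<^sup>2)"
      unfolding U1_def finite_parseval[OF wM(2) sub(1)] by (simp add: norm_mult)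
    also have "\<dots> \<le> 2 * real M * (\<Sum>s\<in>?I. \<eta>\<^sup>2)"
      by (intro mult_left_mono sum_mono power_mono e_le) auto
    finally show ?thesis by (simp add: mult_ac)
  qed
  have V1: "(\<Sum>j<2*M. (cmod (V1 j))\<^sup>2) \<le> 2 * real M * (4 * real w + 1)"
    unfolding V1_def finite_parseval[OF wM(2) sub(2)] by (simp add: norm_mult)
  have U2: "(\<Sum>j<2*M. (cmod (U2 j))\<^sup>2) \<le> 2 * real M * (2 * real w + 1)"
    unfolding U2_def finite_parseval[OF wM(2) sub(1)] by (simp add: norm_mult)
  have V2: "(\<Sum>j<2*M. (cmod (V2 j))\<^sup>2) \<le> (2 * real M * (4 * real w + 1)) * \<eta>\<^sup>2"
  proof -
    have "(\<Sum>j<2*M. (cmod (V2 j))\<^sup>2) = 2 * real M * (\<Sum>s\<in>?J. (cmod (?e s - 1))\<^sup>2)"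
      unfolding V2_def finite_parseval[OF wM(2) sub(2)] by (simp add: norm_mult)
    also have "\<dots> \<le> 2 * real M * (\<Sum>s\<in>?J. \<eta>\<^sup>2)"
      by (intro mult_left_mono sum_mono power_mono e_le) auto
    finally show ?thesis by (simp add: mult_ac)
  qed
  \<comment> \<open>The trapezoid is a convolution of two indicator functions, so its Fourier transform is a
    product, and the difference operator obeys the Leibniz rule.\<close>
  have "(\<Sum>m\<in>{- int M..<int M}. (?e m - 1) * trapezoid w m * ?e (m * (c - int j))) =
    (U1 j * V1 j + V2 j * U2 j) / (2 * real w + 1)" for j
  proof -
    have "(\<Sum>m\<in>{- int M..<int M}. (?e m - 1) * trapezoid w m * ?e (m * (c - int j))) =
      (\<Sum>m\<in>{- int M..<int M}. ((?e m - 1) * ?e (m * (c - int j))) * trapezoid w m)"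
      by (simp add: mult_ac)
    also have "\<dots> = (\<Sum>s\<in>?I. \<Sum>t\<in>?J. (?e (s + t) - 1) * ?e ((s + t) * (c - int j))) / (2 * real w + 1)"
      by (rule sum_mult_trapezoid[OF wM(1)])
    also have "(\<Sum>s\<in>?I. \<Sum>t\<in>?J. (?e (s + t) - 1) * ?e ((s + t) * (c - int j))) =
       (\<Sum>s\<in>?I. \<Sum>t\<in>?J. ((?e s - 1) * ?e (s * c) * ?e (- s * int j)) * (?e t * ?e (t * c) * ?e (- t * int j))
         + (?e (s * c) * ?e (- s * int j)) * ((?e t - 1) * ?e (t * c) * ?e (- t * int j)))"
    proof (intro sum.cong refl)
      fix s t
      have leibniz: "(x * y - 1) * (a * b * (a' * b')) = (x - 1) * a * b * (y * a' * b') + a * b * ((y - 1) * a' * b')"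
        for x y a b a' b' :: complex
        by (simp add: algebra_simps)
      have "?e ((s + t) * (c - int j)) = ?e (s * c) * ?e (- s * int j) * (?e (t * c) * ?e (- t * int j))"
        by (simp only: unity_root_add[symmetric]) (simp add: algebra_simps)
      then show "(?e (s + t) - 1) * ?e ((s + t) * (c - int j)) =
        ((?e s - 1) * ?e (s * c) * ?e (- s * int j)) * (?e t * ?e (t * c) * ?e (- t * int j))
         + (?e (s * c) * ?e (- s * int j)) * ((?e t - 1) * ?e (t * c) * ?e (- t * int j))"
        by (simp only: unity_root_add leibniz)
    qed
    also have "\<dots> = U1 j * V1 j + V2 j * U2 j"
      unfolding mult.commute[of "V2 j"]
      by (simp only: U1_def V1_def U2_def V2_def sum_product sum.distrib)
    finally show ?thesis by simp
  qed
  then have "(\<Sum>j<2*M. cmod (\<Sum>m\<in>{- int M..<int M}.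
      (?e m - 1) * trapezoid w m * ?e (m * (c - int j)))) =
    (\<Sum>j<2*M. cmod (U1 j * V1 j + V2 j * U2 j)) / (2 * real w + 1)"
    by (simp only: sum_divide_distrib norm_divide norm_of_real)
  also have "\<dots> \<le> ((\<Sum>j<2*M. cmod (U1 j * V1 j)) + (\<Sum>j<2*M. cmod (V2 j * U2 j))) / (2 * real w + 1)"
    unfolding sum.distrib[symmetric] by (intro divide_right_mono sum_mono norm_triangle_ineq) simp
  also have "\<dots> \<le> (2 * real M * (3 * (2 * real w + 1)) * \<eta>) / (2 * real w + 1)"
  proof (rule divide_right_mono)
    have "(\<Sum>j<2*M. cmod (U1 j * V1 j)) + (\<Sum>j<2*M. cmod (V2 j * U2 j)) \<le>
      (2 * real M * (2 * real w + 1) + 2 * real M * (4 * real w + 1)) / 2 * \<eta> +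
      (2 * real M * (4 * real w + 1) + 2 * real M * (2 * real w + 1)) / 2 * \<eta>"
      by (intro add_mono sum_norm_mult_le U1 V1 U2 V2 \<eta>)
    \<comment> \<open>The window lengths \<open>2 * w + 1\<close> and \<open>4 * w + 1\<close> add
      up to at most three times the normalising factor, so \<open>w\<close> cancels in the
      end.\<close>
    also have "\<dots> = 2 * real M * (6 * real w + 2) * \<eta>" by (simp add: field_simps)
    also have "\<dots> \<le> 2 * real M * (3 * (2 * real w + 1)) * \<eta>"
      using \<eta> by (intro mult_right_mono mult_left_mono) auto
    finally show "(\<Sum>j<2*M. cmod (U1 j * V1 j)) + (\<Sum>j<2*M. cmod (V2 j * U2 j)) \<le> \<dots>" .
  qed simp
  also have "\<dots> = 2 * real M * (6 * pi / q)"
  proof -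
    have cancel: "x * (3 * y) * \<eta> / y = x * (3 * \<eta>)" if "y \<noteq> 0" for x y
      using that by simp
    have "2 * real w + 1 \<noteq> 0" by linarith
    from cancel[OF this, of "2 * real M"] show ?thesis by (simp add: \<eta>_def)
  qed
  finally show ?thesis .
qed

section \<open>Almost orbits and the resolvent on the circle\<close>

interpretation complex_vector: vector_space "scaleC :: complex \<Rightarrow> 'a::cnormed_vector \<Rightarrow> 'a"
  by unfold_locales (auto simp: scaleC_add_right scaleC_add_left scaleC_scaleC scaleC_one)

text \<open>The lower bound given by a bounded inverse at \<open>z0\<close> survives perturbation:
  on the ball of radius \<open>1 / (2 * B)\<close> it holds with the doubled constant, because half
  of \<open>norm y\<close> can be absorbed. Compactness leaves finitely many balls.\<close>

lemma bounded_below_on_compact: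
  fixes T :: "'a::cnormed_vector \<Rightarrow>\<^sub>L 'a"
  assumes "compact K" "K \<inter> cspectrum T = {}"
  obtains \<beta> where "\<beta> > 0" "\<And>z y. z \<in> K \<Longrightarrow> norm y \<le> \<beta> * norm (scaleC z y - T y)"
proof -
  have "\<exists>e \<beta>. e > 0 \<and> \<beta> > 0 \<and> (\<forall>z\<in>ball z0 e. \<forall>y. norm y \<le> \<beta> * norm (scaleC z y - T y))"
    if z0: "z0 \<in> K" for z0
  proof -
    from z0 assms(2) obtain S where S: "bounded_linear S" "\<And>x. S (scaleC z0 x - T x) = x"
      unfolding cspectrum_def by blast
    from bounded_linear.pos_bounded[OF S(1)] obtain B
      where B: "B > 0" "\<And>x. norm (S x) \<le> norm x * B" by blast
    have "norm y \<le> 2 * B * norm (scaleC z y - T y)" if "z \<in> ball z0 (1 / (2 * B))" for z y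
    proof -
      have "norm y \<le> norm (scaleC z0 y - T y) * B"
        using B(2)[of "scaleC z0 y - T y"] S(2) by simp
      also have "scaleC z0 y - T y = scaleC (z0 - z) y + (scaleC z y - T y)"
        by (simp add: complex_vector.scale_left_diff_distrib)
      also have "norm \<dots> * B \<le> (cmod (z0 - z) * norm y + norm (scaleC z y - T y)) * B"
        using B(1) norm_triangle_ineq[of "scaleC (z0 - z) y" "scaleC z y - T y"]
        by (intro mult_right_mono) (auto simp: norm_scaleC)
      also have "\<dots> \<le> (1 / (2 * B) * norm y + norm (scaleC z y - T y)) * B"
        using B(1) that by (intro mult_right_mono add_right_mono) (auto simp: dist_norm)
      also have "\<dots> = norm y / 2 + norm (scaleC z y - T y) * B"
        using B(1) by (simp add: field_simps)
      finally show ?thesis by (simp add: mult_ac)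
    qed
    then show ?thesis
      using B(1) by (intro exI[of _ "1 / (2 * B)"] exI[of _ "2 * B"]) auto
  qed
  then obtain e \<beta> where e: "\<And>z0. z0 \<in> K \<Longrightarrow> e z0 > 0" and \<beta>: "\<And>z0. z0 \<in> K \<Longrightarrow> \<beta> z0 > 0"
    and bd: "\<And>z0 z y. z0 \<in> K \<Longrightarrow> z \<in> ball z0 (e z0) \<Longrightarrow> norm y \<le> \<beta> z0 * norm (scaleC z y - T y)"
    by metis
  have cover: "K \<subseteq> (\<Union>z0\<in>K. ball z0 (e z0))" using e by force
  from compactE_image[OF assms(1) _ cover] obtain C where C: "C \<subseteq> K" "finite C" "K \<subseteq> (\<Union>z0\<in>C. ball z0 (e z0))"
    by auto
  show ?thesis
  proof (rule that)
    have "0 \<le> (\<Sum>z0\<in>C. \<beta> z0)" using \<beta> C(1) by (intro sum_nonneg) (auto simp: less_imp_le)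
    \<comment> \<open>The summand 1 keeps the constant positive even for an empty subcover; the sum
      dominates every local constant.\<close>
    then show "0 < 1 + (\<Sum>z0\<in>C. \<beta> z0)" by linarith
    fix z y assume "z \<in> K"
    then obtain z0 where z0: "z0 \<in> C" "z \<in> ball z0 (e z0)" using C(3) by blast
    have "\<beta> z0 \<le> (\<Sum>z0\<in>C. \<beta> z0)"
      using \<beta> C z0(1) by (intro member_le_sum) (auto simp: less_imp_le)
    then have "\<beta> z0 * norm (scaleC z y - T y) \<le> (1 + (\<Sum>z0\<in>C. \<beta> z0)) * norm (scaleC z y - T y)"
      by (intro mult_right_mono) auto
    with bd[of z0 z y] z0 C(1) show "norm y \<le> (1 + (\<Sum>z0\<in>C. \<beta> z0)) * norm (scaleC z y - T y)"
      by (meson order.trans subsetD)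
  qed
qed

text \<open>Replacing \<open>T (b j)\<close> by \<open>b (Suc j)\<close> minus its defect makes the
  sum telescope. For an exact orbit only two boundary terms remain, whatever the length of the
  window.\<close>

lemma rect_window_eq:
  fixes T :: "'a::cnormed_vector \<Rightarrow>\<^sub>L 'a"
  assumes "clinear_op T" "z \<noteq> 0"
  shows "scaleC z (\<Sum>i<M. scaleC (inverse z ^ (a + i)) (b (a + i)))
      - T (\<Sum>i<M. scaleC (inverse z ^ (a + i)) (b (a + i))) =
    scaleC z (scaleC (inverse z ^ a) (b a) - scaleC (inverse z ^ (a + M)) (b (a + M)))
      + (\<Sum>i<M. scaleC (inverse z ^ (a + i)) (b (Suc (a + i)) - T (b (a + i))))"
proof (induction M)
  case 0
  then show ?case by simp
next
  case (Suc M)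
  have T: "T (scaleC c x) = scaleC c (T x)" for c x
    using assms(1) by (simp add: clinear_op_def)
  show ?case
    using Suc assms(2)
    by (simp add: T complex_vector.scale_right_distrib complex_vector.scale_right_diff_distrib
        blinfun.add_right algebra_simps)
qed

lemma norm_rect_window_le:
  fixes T :: "'a::cnormed_vector \<Rightarrow>\<^sub>L 'a"
  assumes "clinear_op T" "cmod z = 1" "\<beta> > 0"
    and below: "\<And>y. norm y \<le> \<beta> * norm (scaleC z y - T y)"
    and B: "\<And>j. j \<le> a + M \<Longrightarrow> norm (b j) \<le> B"
    and E: "\<And>j. j < a + M \<Longrightarrow> norm (b (Suc j) - T (b j)) \<le> E"
  shows "norm (\<Sum>i<M. scaleC (inverse z ^ (a + i)) (b (a + i))) \<le> \<beta> * (2 * B + real M * E)"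
proof -
  have z: "z \<noteq> 0" using assms(2) by auto
  have unit: "cmod (inverse z ^ j) = 1" for j
    using assms(2) by (simp add: norm_power norm_inverse)
  have "norm (scaleC z (scaleC (inverse z ^ a) (b a) - scaleC (inverse z ^ (a + M)) (b (a + M)))
      + (\<Sum>i<M. scaleC (inverse z ^ (a + i)) (b (Suc (a + i)) - T (b (a + i)))))
    \<le> (B + B) + (\<Sum>i<M. E)"
  proof (rule order.trans[OF norm_triangle_ineq add_mono])
    have "norm (scaleC (inverse z ^ a) (b a) - scaleC (inverse z ^ (a + M)) (b (a + M))) \<le> norm (b a) + norm (b (a + M))"
      by (rule order.trans[OF norm_triangle_ineq4]) (simp only: norm_scaleC unit mult_1 order.refl)
    also have "\<dots> \<le> B + B" by (intro add_mono B) auto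
    finally show "norm (scaleC z (scaleC (inverse z ^ a) (b a) - scaleC (inverse z ^ (a + M)) (b (a + M)))) \<le> B + B"
      by (simp add: norm_scaleC[of z] assms(2))
    show "norm (\<Sum>i<M. scaleC (inverse z ^ (a + i)) (b (Suc (a + i)) - T (b (a + i)))) \<le> (\<Sum>i<M. E)"
      by (rule sum_norm_le) (simp only: norm_scaleC unit mult_1, rule E, simp)
  qed
  then show ?thesis
    using order.trans[OF below mult_left_mono[OF _ less_imp_le[OF assms(3)]]]
    unfolding rect_window_eq[OF assms(1) z, symmetric] by simp
qed

text \<open>Averaging rectangular windows produces the Fejer kernel; on it two factors of
  the resolvent can be spent, which gains a factor \<open>1 / M\<close>.\<close>

lemma norm_fejer_window_le:
  fixes T :: "'a::cnormed_vector \<Rightarrow>\<^sub>L 'a"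
  assumes "clinear_op T" "cmod z = 1" "\<beta> > 0"
    and below: "\<And>y. norm y \<le> \<beta> * norm (scaleC z y - T y)"
    and B: "\<And>j. j \<le> 2 * M \<Longrightarrow> norm (b j) \<le> B"
    and E: "\<And>j. j < 2 * M \<Longrightarrow> norm (b (Suc j) - T (b j)) \<le> E"
  shows "norm (\<Sum>a<M. \<Sum>i<M. scaleC (inverse z ^ (a + i)) (b (a + i)))
    \<le> \<beta> * (2 * \<beta> * (2 * B + real M * E) + real M * real M * E)"
proof -
  have z: "z \<noteq> 0" using assms(2) by auto
  have unit: "cmod (inverse z ^ j) = 1" for j
    using assms(2) by (simp add: norm_power norm_inverse)
  let ?W = "\<lambda>a. \<Sum>i<M. scaleC (inverse z ^ (a + i)) (b (a + i))"
  let ?e = "\<lambda>j. scaleC (inverse z ^ j) (b (Suc j) - T (b j))"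
  have "scaleC z (\<Sum>a<M. ?W a) - T (\<Sum>a<M. ?W a) = (\<Sum>a<M. scaleC z (?W a) - T (?W a))"
    by (simp only: complex_vector.scale_sum_right blinfun.sum_right sum_subtractf)
  also have "\<dots> = (\<Sum>a<M. scaleC z (scaleC (inverse z ^ a) (b a) - scaleC (inverse z ^ (a + M)) (b (a + M)))
      + (\<Sum>i<M. ?e (a + i)))"
    by (simp only: rect_window_eq[OF assms(1) z])
  \<comment> \<open>Summed over \<open>a\<close>, the boundary terms form the rectangular windows
    starting at 0 and at \<open>M\<close>, to which the resolvent bound applies a second
    time.\<close>
  also have "\<dots> = scaleC z (?W 0 - ?W M) + (\<Sum>a<M. \<Sum>i<M. ?e (a + i))"
    by (simp only: sum.distrib sum_subtractf complex_vector.scale_sum_right[symmetric] add_0 add.commute[of M])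
  finally have eq: "scaleC z (\<Sum>a<M. ?W a) - T (\<Sum>a<M. ?W a) =
    scaleC z (?W 0 - ?W M) + (\<Sum>a<M. \<Sum>i<M. ?e (a + i))" .
  have "norm (scaleC z (?W 0 - ?W M) + (\<Sum>a<M. \<Sum>i<M. ?e (a + i)))
    \<le> (\<beta> * (2 * B + real M * E) + \<beta> * (2 * B + real M * E)) + (\<Sum>a<M. \<Sum>i<M. E)"
  proof (rule order.trans[OF norm_triangle_ineq add_mono])
    have "norm (?W 0) \<le> \<beta> * (2 * B + real M * E)" "norm (?W M) \<le> \<beta> * (2 * B + real M * E)"
      using norm_rect_window_le[OF assms(1-3) below, of 0 M b B E]
        norm_rect_window_le[OF assms(1-3) below, of M M b B E] B E by auto
    then show "norm (scaleC z (?W 0 - ?W M)) \<le> \<beta> * (2 * B + real M * E) + \<beta> * (2 * B + real M * E)"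
      using norm_triangle_ineq4[of "?W 0" "?W M"] by (simp add: norm_scaleC[of z] assms(2))
    show "norm (\<Sum>a<M. \<Sum>i<M. ?e (a + i)) \<le> (\<Sum>a<M. \<Sum>i<M. E)"
      by (intro sum_norm_le) (simp only: norm_scaleC unit mult_1, rule E, simp)
  qed
  then have "norm (\<Sum>a<M. ?W a) \<le> \<beta> * ((\<beta> * (2 * B + real M * E) + \<beta> * (2 * B + real M * E))
      + (\<Sum>a<M. \<Sum>i<M. E))"
    unfolding eq[symmetric] 
    by - (rule order.trans[OF below mult_left_mono[OF _ less_imp_le[OF assms(3)]]])
  then show ?thesis by (simp add: algebra_simps)
qed

text \<open>The two closed arcs of angles form a compact subset of the circle that misses 1, hence
  misses the spectrum.\<close>

lemma bounded_below_off_1: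
  fixes T :: "'a::cnormed_vector \<Rightarrow>\<^sub>L 'a"
  assumes "cspectrum T \<inter> sphere 0 1 \<subseteq> {1}" "q > 0"
  obtains \<beta> where "\<beta> > 0"
    "\<And>\<theta> y. pi / q \<le> \<bar>\<theta>\<bar> \<Longrightarrow> \<bar>\<theta>\<bar> \<le> pi \<Longrightarrow> norm y \<le> \<beta> * norm (scaleC (cis \<theta>) y - T y)"
proof -
  let ?A = "{- pi..- (pi / q)} \<union> {pi / q..pi}"
  have "compact (cis ` ?A)"
    by (intro compact_continuous_image continuous_intros compact_Un compact_Icc)
  moreover have "cis ` ?A \<inter> cspectrum T = {}"
  proof -
    have "cis \<theta> \<noteq> 1" if "\<theta> \<in> ?A" for \<theta>
    proof
      have pq: "0 < pi / q" using assms(2) by simp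
      assume "cis \<theta> = 1"
      then have "cos \<theta> = 1" by (metis cis.simps(1) one_complex.simps(1))
      then have "cos \<bar>\<theta>\<bar> = cos 0" by simp
      then have "\<bar>\<theta>\<bar> = 0" using that pq by (intro cos_inj_pi[of "\<bar>\<theta>\<bar>" 0]) auto
      then show False using that pq by auto
    qed
    then have "\<And>\<theta>. \<theta> \<in> ?A \<Longrightarrow> cis \<theta> \<in> sphere 0 1 - {1}" by simp
    then show ?thesis using assms(1) by blast
  qed
  ultimately obtain \<beta> where \<beta>: "\<beta> > 0"
    "\<And>z y. z \<in> cis ` ?A \<Longrightarrow> norm y \<le> \<beta> * norm (scaleC z y - T y)"
    using bounded_below_on_compact by metis
  show ?thesis
    by (rule that[OF \<beta>(1)], rule \<beta>(2), rule imageI) (auto simp: abs_if split: if_splits)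
qed

section \<open>From the circle to increments of almost orbits\<close>

lemma fourier_inversion_difference:
  assumes "M > 0" "j < 2 * M"
  shows "(\<Sum>m\<in>{- int M..<int M}. (unity_root (2*M) m - 1) * unity_root (2*M) (m * (int M - 1 - int j)))
    = of_nat (2 * M) * (of_bool (j = M) - of_bool (Suc j = M))"
proof -
  let ?e = "unity_root (2*M)"
  have "(\<Sum>m\<in>{- int M..<int M}. (?e m - 1) * ?e (m * (int M - 1 - int j))) =
    (\<Sum>m\<in>{- int M..<int M}. ?e ((int M - int j) * m) - ?e ((int M - 1 - int j) * m))"
  proof (rule sum.cong[OF refl])
    fix m
    have "?e ((int M - int j) * m) = ?e m * ?e (m * (int M - 1 - int j))"
      by (simp add: unity_root_add[symmetric] algebra_simps)
    then show "(?e m - 1) * ?e (m * (int M - 1 - int j)) =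
      ?e ((int M - int j) * m) - ?e ((int M - 1 - int j) * m)"
      by (simp add: left_diff_distrib mult.commute)
  qed
  also have "\<dots> = of_nat (2 * M) * (of_bool (j = M) - of_bool (Suc j = M))"
  proof -
    \<comment> \<open>For \<open>j < 2 * M\<close> both exponents are smaller than a period in
      modulus, so they are divisible by it only when they vanish.\<close>
    have *: "2 * int M dvd k \<longleftrightarrow> k = 0" if "\<bar>k\<bar> < 2 * int M" for k
      using that dvd_imp_le_int[of k "2 * int M"] by force
    have 1: "2 * int M dvd int M - int j \<longleftrightarrow> j = M"
      using assms by (subst *) auto
    have 2: "2 * int M dvd int M - 1 - int j \<longleftrightarrow> Suc j = M"
      using assms by (subst *) auto
    show ?thesis
      using assms(1) by (simp only: sum_subtractf sum_unity_root_centred 1 2) simp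
  qed
  finally show ?thesis .
qed

text \<open>Each of the \<open>M\<close> windows contains the index \<open>M - 1\<close>, and all
  but the one starting at 0 contain \<open>M\<close>. The increment is therefore picked up
  \<open>M\<close> times, with a single \<open>b M\<close> missing.\<close>

lemma sum_difference_of_windows:
  fixes b :: "nat \<Rightarrow> 'a::cnormed_vector"
  assumes "M > 0"
  shows "(\<Sum>a<M. \<Sum>i<M. scaleC (of_bool (a + i = M) - of_bool (Suc (a + i) = M)) (b (a + i)))
    = real M *\<^sub>R (b M - b (M - 1)) - b M"
proof -
  have "(\<Sum>i<M. scaleC (of_bool (a + i = M) - of_bool (Suc (a + i) = M)) (b (a + i))) =
    (if a = 0 then 0 else b M) - b (M - 1)" if "a < M" for a
  proof -
    have "(\<Sum>i<M. scaleC (of_bool (a + i = M) - of_bool (Suc (a + i) = M)) (b (a + i))) =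
      (\<Sum>i<M. (if i = M - a then b M else 0) - (if i = M - 1 - a then b (M - 1) else 0))"
      using that by (intro sum.cong refl) (auto simp: complex_vector.scale_left_diff_distrib)
    also have "\<dots> = (if a = 0 then 0 else b M) - b (M - 1)"
      using that by (auto simp: sum_subtractf)
    finally show ?thesis .
  qed
  then have "(\<Sum>a<M. \<Sum>i<M. scaleC (of_bool (a + i = M) - of_bool (Suc (a + i) = M)) (b (a + i))) =
    (\<Sum>a<M. (if a = 0 then 0 else b M) - b (M - 1))"
    by (intro sum.cong refl) simp
  also have "\<dots> = (\<Sum>a<M. b M - b (M - 1) - (if a = 0 then b M else 0))"
    by (intro sum.cong refl) simp
  also have "\<dots> = real M *\<^sub>R (b M - b (M - 1)) - b M"
    using assms by (simp only: sum_subtractf) (simp add: sum_constant_scaleR scaleR_diff_right)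
  finally show ?thesis .
qed

text \<open>Averaging over \<open>M\<close> windows multiplies the increment by \<open>M\<close>.
  The part localised at 1 costs \<epsilon>/3 times \<open>B\<close> per window, while the rest costs
  a multiple of \<open>B\<close> independent of \<open>M\<close> plus defects, so division by
  \<open>M\<close> wins. As \<open>M\<close> and \<open>K\<close> do not depend on \<open>b\<close>,
  one choice serves all vectors and all starting points.\<close>

lemma increment_of_almost_orbit:
  fixes T :: "'a::cnormed_vector \<Rightarrow>\<^sub>L 'a"
  assumes "clinear_op T" "cspectrum T \<inter> sphere 0 1 \<subseteq> {1}" "\<epsilon> > 0"
  obtains M K where "M > 0" "K \<ge> 0"
    "\<And>b B E. (\<And>j. j \<le> 2 * M \<Longrightarrow> norm (b j) \<le> B) \<Longrightarrow>
       (\<And>j. j < 2 * M \<Longrightarrow> norm (b (Suc j) - T (b j)) \<le> E) \<Longrightarrow>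
       norm (b M - b (M - 1)) \<le> \<epsilon> * B + K * E"
proof -
  \<comment> \<open>\<open>q\<close> comes first and brings the Wiener norm of the localised part
    below \<epsilon>/3. It determines \<beta>, and only then is \<open>w\<close> chosen.\<close>
  obtain q0 :: nat where q0: "real q0 > 18 * pi / \<epsilon>" using reals_Archimedean2 by blast
  define q where "q = max q0 4"
  have q: "q \<ge> 4" "6 * pi / q \<le> \<epsilon> / 3"
  proof -
    have "real q > 18 * pi / \<epsilon>" using q0 by (simp add: q_def)
    then show "6 * pi / q \<le> \<epsilon> / 3" using assms(3) by (simp add: q_def field_simps)
  qed (simp add: q_def)
  obtain \<beta> where \<beta>: "\<beta> > 0"
    "\<And>\<theta> y. pi / q \<le> \<bar>\<theta>\<bar> \<Longrightarrow> \<bar>\<theta>\<bar> \<le> pi \<Longrightarrow> norm y \<le> \<beta> * norm (scaleC (cis \<theta>) y - T y)"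
    using bounded_below_off_1[OF assms(2), of "real q"] q(1) by auto
  \<comment> \<open>The 1 pays for the leftover \<open>b M\<close>, and
    \<open>8 * \<beta>\<^sup>2\<close> for the boundary terms of the Fejer bound; together they must
    not exceed \<epsilon>/3 times \<open>M\<close>.\<close>
  obtain w0 :: nat where w0: "real w0 > 3 * (1 + 8 * \<beta>\<^sup>2) / \<epsilon>" using reals_Archimedean2 by blast
  define w where "w = max w0 1"
  define M where "M = q * w"
  have w: "w \<ge> 1" by (simp add: w_def)
  have M: "M > 0" using q(1) w by (simp add: M_def)
  have "real w > 3 * (1 + 8 * \<beta>\<^sup>2) / \<epsilon>" using w0 by (simp add: w_def)
  moreover have "w \<le> M" using q(1) by (simp add: M_def)
  ultimately have "real M > 3 * (1 + 8 * \<beta>\<^sup>2) / \<epsilon>" by linarith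
  then have M_large: "1 + 8 * \<beta>\<^sup>2 \<le> \<epsilon> / 3 * M" using assms(3) by (simp add: field_simps)
  let ?e = "unity_root (2*M)"
  let ?m = "{- int M..<int M}"
  define P where "P j = (\<Sum>m\<in>?m. (?e m - 1) * trapezoid w m * ?e (m * (int M - 1 - int j))) / of_nat (2*M)" for j
  define \<psi> where "\<psi> m = (?e m - 1) * (1 - trapezoid w m) / of_nat (2*M)" for m
  define R where "R j = (\<Sum>m\<in>?m. \<psi> m * ?e (m * (int M - 1 - int j)))" for j
  have PR: "of_bool (j = M) - of_bool (Suc j = M) = P j + R j" if "j < 2 * M" for j
  proof -
    have "P j + R j = (\<Sum>m\<in>?m. (?e m - 1) * ?e (m * (int M - 1 - int j))) / of_nat (2*M)"
      unfolding P_def R_def \<psi>_def sum_divide_distrib sum.distrib[symmetric]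
      by (intro sum.cong refl) (simp add: add_divide_distrib[symmetric] algebra_simps)
    then show ?thesis
      using M unfolding fourier_inversion_difference[OF M that] by simp
  qed
  have sum_P: "(\<Sum>j<2*M. cmod (P j)) \<le> \<epsilon> / 3"
  proof -
    have "(\<Sum>j<2*M. cmod (P j)) = (\<Sum>j<2*M. cmod (\<Sum>m\<in>?m.
      (?e m - 1) * trapezoid w m * ?e (m * (int M - 1 - int j)))) / (2 * real M)"
      by (simp only: P_def norm_divide norm_of_nat sum_divide_distrib[symmetric]
          of_nat_mult[where 'a=real] of_nat_numeral)
    also have "\<dots> \<le> 2 * real M * (6 * pi / q) / (2 * real M)"
      by (intro divide_right_mono wiener_norm_trapezoid_le q w M_def) simp
    also have "\<dots> = 6 * pi / q" using M by simp
    finally show ?thesis using q(2) by linarith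
  qed
  show ?thesis
  proof (rule that)
    show "M > 0" by (fact M)
    \<comment> \<open>This is the coefficient of \<open>E\<close> in \<open>2 * \<Phi> / M\<close>,
      with the Fejer bound \<Phi> defined below.\<close>
    show "0 \<le> 4 * \<beta>\<^sup>2 + 2 * \<beta> * M" using \<beta>(1) by simp
    fix b :: "nat \<Rightarrow> 'a" and B E
    assume B: "\<And>j. j \<le> 2 * M \<Longrightarrow> norm (b j) \<le> B"
      and E: "\<And>j. j < 2 * M \<Longrightarrow> norm (b (Suc j) - T (b j)) \<le> E"
    have B0: "B \<ge> 0" using order.trans[OF norm_ge_zero B[of 0]] by simp
    define F where "F m = (\<Sum>a<M. \<Sum>i<M. scaleC (?e (- m * int (a + i))) (b (a + i)))" for m
    define \<Phi> where "\<Phi> = \<beta> * (2 * \<beta> * (2 * B + real M * E) + real M * real M * E)"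
    have "E \<ge> 0" using order.trans[OF norm_ge_zero E[of 0]] M by simp
    then have \<Phi>0: "\<Phi> \<ge> 0" unfolding \<Phi>_def using B0 \<beta>(1) by (intro mult_nonneg_nonneg add_nonneg_nonneg) auto
    have \<psi>F: "norm (scaleC (\<psi> m * ?e (m * (int M - 1))) (F m)) \<le> \<Phi> / M" if "m \<in> ?m" for m
    proof (cases "\<bar>m\<bar> \<le> int w")
      case True
      \<comment> \<open>On the plateau \<open>1 - trapezoid w m\<close> vanishes, so frequencies
        near 1 call for no resolvent bound.\<close>
      then show ?thesis using \<Phi>0 by (simp add: \<psi>_def trapezoid_eq_1)
    next
      case False
      let ?\<theta> = "2 * pi * of_int m / real (2 * M)"
      have m: "real w \<le> \<bar>real_of_int m\<bar>" "\<bar>real_of_int m\<bar> \<le> real M"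
        using that False by auto
      have \<theta>: "\<bar>?\<theta>\<bar> = pi * (\<bar>real_of_int m\<bar> / real M)" by (simp add: abs_mult)
      \<comment> \<open>Because \<open>M = q * w\<close>, the edge \<open>w\<close> of the plateau
        corresponds to the angle \<pi>/q at which the lower bound sets in.\<close>
      have "pi / q = pi * (real w / real M)" using w by (simp add: M_def)
      also have "\<dots> \<le> \<bar>?\<theta>\<bar>" unfolding \<theta> using m by (intro mult_left_mono divide_right_mono) auto
      finally have \<theta>1: "pi / q \<le> \<bar>?\<theta>\<bar>" .
      have "\<bar>?\<theta>\<bar> \<le> pi * 1" unfolding \<theta> using m M by (intro mult_left_mono) auto
      then have "norm y \<le> \<beta> * norm (scaleC (?e m) y - T y)" for y
        unfolding unity_root_def by (intro \<beta>(2) \<theta>1) simp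
      then have "norm (\<Sum>a<M. \<Sum>i<M. scaleC (inverse (?e m) ^ (a + i)) (b (a + i))) \<le> \<Phi>"
        unfolding \<Phi>_def using B E \<beta>(1) assms(1) by (intro norm_fejer_window_le[of T]) auto
      then have F: "norm (F m) \<le> \<Phi>"
        unfolding F_def unity_root_power unity_root_minus .
      have "cmod (\<psi> m) \<le> 1 / M"
      proof -
        have "cmod (?e m - 1) \<le> 2" using norm_triangle_ineq4[of "?e m" 1] by simp
        moreover have "cmod (1 - complex_of_real (trapezoid w m)) \<le> 1"
          using trapezoid_nonneg[of w m] trapezoid_le_1[of w m]
          by (metis abs_of_nonneg diff_ge_0_iff_ge diff_le_eq le_add_same_cancel1 norm_of_real of_real_1 of_real_diff)
        ultimately have "cmod (?e m - 1) * cmod (1 - complex_of_real (trapezoid w m)) \<le> 2 * 1"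
          by (intro mult_mono) auto
        then have "cmod (\<psi> m) \<le> 2 / (2 * real M)"
          unfolding \<psi>_def norm_divide norm_mult using M by (simp add: norm_mult field_simps)
        then show ?thesis by simp
      qed
      then have "cmod (\<psi> m) * norm (F m) \<le> (1 / M) * \<Phi>"
        using F by (intro mult_mono) auto
      then show ?thesis by (simp add: norm_scaleC norm_mult)
    qed
    have "real M *\<^sub>R (b M - b (M - 1)) - b M = (\<Sum>a<M. \<Sum>i<M. scaleC (P (a + i) + R (a + i)) (b (a + i)))"
      unfolding sum_difference_of_windows[OF M, symmetric] by (intro sum.cong refl) (simp add: PR)
    also have "\<dots> = (\<Sum>a<M. \<Sum>i<M. scaleC (P (a + i)) (b (a + i))) + (\<Sum>a<M. \<Sum>i<M. scaleC (R (a + i)) (b (a + i)))"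
      by (simp only: complex_vector.scale_left_distrib sum.distrib)
    also have "(\<Sum>a<M. \<Sum>i<M. scaleC (R (a + i)) (b (a + i))) = (\<Sum>m\<in>?m. scaleC (\<psi> m * ?e (m * (int M - 1))) (F m))"
    proof -
      \<comment> \<open>Splitting off the phase that depends on \<open>j\<close> allows the sums to
        be interchanged, so that the windows assemble into the Fejer sums
        \<open>F m\<close>.\<close>
      have "R j = (\<Sum>m\<in>?m. \<psi> m * ?e (m * (int M - 1)) * ?e (- m * int j))" for j
        unfolding R_def by (intro sum.cong refl) (simp add: mult.assoc unity_root_add[symmetric] algebra_simps)
      then have "(\<Sum>a<M. \<Sum>i<M. scaleC (R (a + i)) (b (a + i))) =
        (\<Sum>a<M. \<Sum>i<M. \<Sum>m\<in>?m. scaleC (\<psi> m * ?e (m * (int M - 1))) (scaleC (?e (- m * int (a + i))) (b (a + i))))"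
        by (simp only: complex_vector.scale_sum_left scaleC_scaleC)
      also have "\<dots> = (\<Sum>a<M. \<Sum>m\<in>?m. \<Sum>i<M. scaleC (\<psi> m * ?e (m * (int M - 1))) (scaleC (?e (- m * int (a + i))) (b (a + i))))"
        by (rule sum.cong[OF refl], rule sum.swap)
      also have "\<dots> = (\<Sum>m\<in>?m. \<Sum>a<M. \<Sum>i<M. scaleC (\<psi> m * ?e (m * (int M - 1))) (scaleC (?e (- m * int (a + i))) (b (a + i))))"
        by (rule sum.swap)
      finally show ?thesis by (simp only: F_def complex_vector.scale_sum_right)
    qed
    finally have main: "real M *\<^sub>R (b M - b (M - 1)) = b M + (\<Sum>a<M. \<Sum>i<M. scaleC (P (a + i)) (b (a + i)))
      + (\<Sum>m\<in>?m. scaleC (\<psi> m * ?e (m * (int M - 1))) (F m))" by (simp add: algebra_simps)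
    have nP: "norm (\<Sum>a<M. \<Sum>i<M. scaleC (P (a + i)) (b (a + i))) \<le> (\<Sum>a<M. \<epsilon> / 3 * B)"
    proof (rule sum_norm_le)
      fix a assume a: "a \<in> {..<M}"
      have "norm (\<Sum>i<M. scaleC (P (a + i)) (b (a + i))) \<le> (\<Sum>i<M. cmod (P (a + i)) * B)"
        using a by (intro sum_norm_le) (auto simp: norm_scaleC intro!: mult_left_mono B)
      also have "\<dots> = (\<Sum>j\<in>(+) a ` {..<M}. cmod (P j)) * B"
        by (simp add: sum.reindex sum_distrib_right)
      \<comment> \<open>Each window lies inside one full period and is charged the whole Wiener
        norm.\<close>
      also have "\<dots> \<le> (\<Sum>j<2*M. cmod (P j)) * B"
        using a B0 by (intro mult_right_mono sum_mono2) auto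
      also have "\<dots> \<le> \<epsilon> / 3 * B" using sum_P B0 by (rule mult_right_mono)
      finally show "norm (\<Sum>i<M. scaleC (P (a + i)) (b (a + i))) \<le> \<epsilon> / 3 * B" .
    qed
    have nR: "norm (\<Sum>m\<in>?m. scaleC (\<psi> m * ?e (m * (int M - 1))) (F m)) \<le> (\<Sum>m\<in>?m. \<Phi> / M)"
      by (intro sum_norm_le \<psi>F)
    have "real M * norm (b M - b (M - 1)) = norm (real M *\<^sub>R (b M - b (M - 1)))" by simp
    also have "\<dots> \<le> B + (\<Sum>a<M. \<epsilon> / 3 * B) + (\<Sum>m\<in>?m. \<Phi> / M)"
      unfolding main by (intro order.trans[OF norm_triangle_ineq] add_mono nP nR B) simp
    \<comment> \<open>There are \<open>2 * M\<close> frequencies, each contributing at most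
      \<open>\<Phi> / M\<close>.\<close>
    also have "\<dots> = B + real M * (\<epsilon> / 3 * B) + 2 * \<Phi>" using M by simp
    also have "\<dots> = (1 + 8 * \<beta>\<^sup>2) * B + real M * (\<epsilon> / 3 * B) + real M * ((4 * \<beta>\<^sup>2 + 2 * \<beta> * M) * E)"
      by (simp add: \<Phi>_def power2_eq_square algebra_simps)
    also have "\<dots> \<le> (\<epsilon> / 3 * M) * B + real M * (\<epsilon> / 3 * B) + real M * ((4 * \<beta>\<^sup>2 + 2 * \<beta> * M) * E)"
      by (intro add_right_mono mult_right_mono M_large B0)
    also have "\<dots> = real M * (2 / 3 * (\<epsilon> * B) + (4 * \<beta>\<^sup>2 + 2 * \<beta> * M) * E)"
      by (simp add: algebra_simps)
    finally have "norm (b M - b (M - 1)) \<le> 2 / 3 * (\<epsilon> * B) + (4 * \<beta>\<^sup>2 + 2 * \<beta> * M) * E"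
      using M by simp
    moreover have "0 \<le> \<epsilon> * B" using assms(3) B0 by simp
    ultimately show "norm (b M - b (M - 1)) \<le> \<epsilon> * B + (4 * \<beta>\<^sup>2 + 2 * \<beta> * M) * E" by linarith
  qed
qed

section \<open>Cesaro kernels and sums\<close>

text \<open>This form covers \<gamma> = 0 without a case distinction and reduces the kernel
  identities to recursions for rising factorials.\<close>

lemma kker_eq_pochhammer:
  assumes "\<gamma> \<ge> 0"
  shows "kker \<gamma> n = pochhammer \<gamma> n / fact n"
proof (cases "\<gamma> = 0")
  case True
  then show ?thesis by (simp add: kker_def pochhammer_0_left)
next
  case False
  then have "\<gamma> \<notin> \<int>\<^sub>\<le>\<^sub>0" using assms nonpos_Ints_nonpos by fastforce
  then show ?thesis
    using False Gamma_fact[of n, where 'a = real]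
    by (simp add: kker_def pochhammer_Gamma add.commute)
qed

lemma kker_0_right: "\<gamma> \<ge> 0 \<Longrightarrow> kker \<gamma> 0 = 1"
  by (simp add: kker_eq_pochhammer)

lemma kker_pos: "\<gamma> > 0 \<Longrightarrow> kker \<gamma> n > 0"
  by (simp add: kker_eq_pochhammer pochhammer_pos)

lemma kker_Suc: "\<gamma> \<ge> 0 \<Longrightarrow> kker \<gamma> (Suc n) = (\<gamma> + n) / (n + 1) * kker \<gamma> n"
  by (simp add: kker_eq_pochhammer pochhammer_Suc field_simps)

lemma mono_kker:
  assumes "\<gamma> \<ge> 1"
  shows "mono (kker \<gamma>)"
proof (rule monoI, rule lift_Suc_mono_le)
  fix n
  have "1 * kker \<gamma> n \<le> (\<gamma> + n) / (n + 1) * kker \<gamma> n"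
    using assms kker_pos[of \<gamma> n] by (intro mult_right_mono) auto
  then show "kker \<gamma> n \<le> kker \<gamma> (Suc n)"
    using assms by (simp add: kker_Suc)
qed

text \<open>Peel the first or the last factor off \<open>pochhammer \<gamma> (n + 1)\<close>. The
  kernel of order \<gamma> is thus smaller by a factor of order n, which makes the defects of the
  almost orbit negligible and later produces the rate o(n).\<close>

lemma kker_add_1:
  assumes "\<gamma> > 0"
  shows "kker (\<gamma> + 1) n = (\<gamma> + n) / \<gamma> * kker \<gamma> n"
proof -
  have "\<gamma> * pochhammer (\<gamma> + 1) n = pochhammer \<gamma> n * (\<gamma> + n)"
    using pochhammer_rec[of \<gamma> n] pochhammer_Suc[of \<gamma> n] by simp
  then show ?thesis
    using assms by (simp add: kker_eq_pochhammer field_simps)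
qed

lemma kker_diff:
  assumes "\<gamma> \<ge> 1"
  shows "kker \<gamma> (Suc n) - kker \<gamma> n = kker (\<gamma> - 1) (Suc n)"
proof -
  have "kker (\<gamma> - 1) (Suc n) = (\<gamma> - 1) / (n + 1) * kker \<gamma> n"
    using assms pochhammer_rec[of "\<gamma> - 1" n] by (simp add: kker_eq_pochhammer field_simps)
  then show ?thesis
    using assms by (simp add: kker_Suc field_simps)
qed

text \<open>Divergence serves to absorb finitely many early Cesaro sums in the estimate of the
  powers.\<close>

lemma filterlim_kker:
  assumes "\<gamma> \<ge> 1"
  shows "filterlim (kker (\<gamma> + 1)) at_top sequentially"
proof (rule filterlim_at_top_mono)
  show "filterlim (\<lambda>n. (\<gamma> + real n) / \<gamma>) at_top sequentially"
    using assms by real_asymp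
  show "\<forall>\<^sub>F n in sequentially. (\<gamma> + real n) / \<gamma> \<le> kker (\<gamma> + 1) n"
  proof (rule always_eventually, rule allI)
    fix n
    have "kker \<gamma> 0 \<le> kker \<gamma> n" using mono_kker[OF assms] by (rule monoD) simp
    then have "(\<gamma> + n) / \<gamma> * 1 \<le> (\<gamma> + n) / \<gamma> * kker \<gamma> n"
      using assms by (intro mult_left_mono) (auto simp: kker_0_right)
    then show "(\<gamma> + n) / \<gamma> \<le> kker (\<gamma> + 1) n"
      using assms by (simp add: kker_add_1)
  qed
qed

text \<open>The window around n reaches a fixed distance beyond n; asymptotically this overshoot
  costs only a factor 1.\<close>

lemma kker_shift_ratio_tendsto:
  assumes "\<gamma> > 0"
  shows "(\<lambda>n. kker \<gamma> (n + m) / kker \<gamma> n) \<longlonglongrightarrow> 1"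
proof (induction m)
  case 0
  have "kker \<gamma> n \<noteq> 0" for n using kker_pos[OF assms, of n] by simp
  then show ?case by simp
next
  case (Suc m)
  have "(\<lambda>n. (\<gamma> + real (n + m)) / (real (n + m) + 1)) \<longlonglongrightarrow> 1" by real_asymp
  from tendsto_mult[OF this Suc] show ?case
    using assms by (simp add: kker_Suc add_ac)
qed

text \<open>Up to the factor \<gamma>, the quotient is the classical product sequence converging to
  the reciprocal Gamma function.\<close>

lemma kker_bigo_powr:
  assumes "\<gamma> > 0"
  shows "kker (\<gamma> + 1) \<in> O(\<lambda>n. real n powr \<gamma>)"
proof -
  have "(\<lambda>n. kker (\<gamma> + 1) n / real n powr \<gamma>) \<longlonglongrightarrow> rGamma \<gamma> / \<gamma>"
  proof (rule Lim_transform_eventually)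
    show "(\<lambda>n. rGamma_series \<gamma> n / \<gamma>) \<longlonglongrightarrow> rGamma \<gamma> / \<gamma>"
      using assms by (intro tendsto_intros) auto
    show "\<forall>\<^sub>F n in sequentially. rGamma_series \<gamma> n / \<gamma> = kker (\<gamma> + 1) n / real n powr \<gamma>"
      using eventually_gt_at_top[of "0::nat"]
    proof eventually_elim
      case (elim n)
      have "pochhammer \<gamma> (n + 1) = \<gamma> * pochhammer (\<gamma> + 1) n"
        using pochhammer_rec[of \<gamma> n] by simp
      then show ?case
        using assms elim by (simp add: rGamma_series_def kker_eq_pochhammer powr_def)
    qed
  qed
  then show ?thesis
    by (rule bigoI_tendsto) (use eventually_gt_at_top[of "0::nat"] in eventually_elim, simp)
qed

section \<open>Cesaro sums of the powers of an operator\<close>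

lemma cesaro_sum_Suc:
  "cesaro_sum \<gamma> T (Suc n) = (T o\<^sub>L cesaro_sum \<gamma> T n) + kker \<gamma> (Suc n) *\<^sub>R id_blinfun"
proof -
  have "T o\<^sub>L cesaro_sum \<gamma> T n = (\<Sum>j\<le>n. kker \<gamma> (n - j) *\<^sub>R op_pow T (Suc j))"
    unfolding cesaro_sum_def
    by (simp add: bounded_bilinear.sum_right[OF bounded_bilinear_blinfun_compose]
        bounded_bilinear.scaleR_right[OF bounded_bilinear_blinfun_compose])
  \<comment> \<open>The term \<open>j = 0\<close> is the only one without a factor \<open>T\<close>;
    it is the defect of the almost orbit.\<close>
  then show ?thesis
    unfolding cesaro_sum_def by (subst sum.atMost_Suc_shift) (simp add: add.commute)
qed

lemma cesaro_sum_diff: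
  assumes "\<gamma> \<ge> 1"
  shows "cesaro_sum \<gamma> T (Suc n) - cesaro_sum \<gamma> T n = cesaro_sum (\<gamma> - 1) T (Suc n)"
proof -
  \<comment> \<open>The new top term has coefficient 1 for both orders, since every kernel takes the
    value 1 at 0.\<close>
  have "cesaro_sum \<gamma> T (Suc n) - cesaro_sum \<gamma> T n =
    (\<Sum>j\<le>n. (kker \<gamma> (Suc (n - j)) - kker \<gamma> (n - j)) *\<^sub>R op_pow T j) + op_pow T (Suc n)"
    using assms by (simp add: cesaro_sum_def Suc_diff_le kker_0_right sum_subtractf scaleR_left_diff_distrib)
  also have "\<dots> = cesaro_sum (\<gamma> - 1) T (Suc n)"
    using assms by (simp add: cesaro_sum_def kker_diff Suc_diff_le kker_0_right)
  finally show ?thesis .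
qed

text \<open>The coefficients are those of \<open>(1 - z) powr \<gamma>\<close>, whose power series
  is the reciprocal of the generating function of \<open>kker \<gamma>\<close>; convolving with them
  undoes the summation.\<close>

lemma op_pow_eq_sum_cesaro_sum:
  assumes "\<gamma> \<ge> 0"
  shows "op_pow T n = (\<Sum>j\<le>n. (pochhammer (- \<gamma>) j / fact j) *\<^sub>R cesaro_sum \<gamma> T (n - j))"
proof -
  let ?c = "\<lambda>j. pochhammer (- \<gamma>) j / fact j"
  have conv: "(\<Sum>j\<le>m. ?c j * kker \<gamma> (m - j)) = of_bool (m = 0)" for m
  proof -
    have "(\<Sum>j\<le>m. ?c j * kker \<gamma> (m - j)) =
      (\<Sum>j\<le>m. of_nat (m choose j) * pochhammer (- \<gamma>) j * pochhammer \<gamma> (m - j)) / fact m"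
      unfolding sum_divide_distrib using assms
      by (intro sum.cong refl) (simp add: kker_eq_pochhammer binomial_fact field_simps)
    \<comment> \<open>Vandermonde convolution for rising factorials; the parameters cancel, leaving
      the unit of convolution.\<close>
    also have "\<dots> = pochhammer (- \<gamma> + \<gamma>) m / fact m"
      by (simp only: pochhammer_binomial_sum)
    finally show ?thesis by (simp add: pochhammer_0_left)
  qed
  have "(\<Sum>j\<le>n. ?c j *\<^sub>R cesaro_sum \<gamma> T (n - j)) =
    (\<Sum>j\<le>n. \<Sum>i\<in>{i \<in> {..n}. i + j \<le> n}. (?c j * kker \<gamma> (n - j - i)) *\<^sub>R op_pow T i)"
    unfolding cesaro_sum_def scaleR_sum_right
    by (intro sum.cong) auto
  also have "\<dots> = (\<Sum>i\<le>n. \<Sum>j\<in>{j \<in> {..n}. i + j \<le> n}. (?c j * kker \<gamma> (n - j - i)) *\<^sub>R op_pow T i)"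
    by (rule sum.swap_restrict) auto
  also have "\<dots> = (\<Sum>i\<le>n. (\<Sum>j\<le>n - i. ?c j * kker \<gamma> (n - i - j)) *\<^sub>R op_pow T i)"
    unfolding scaleR_sum_left
    by (intro sum.cong) (auto simp: add.commute)
  also have "\<dots> = (\<Sum>i\<le>n. if i = n then op_pow T n else 0)"
    by (intro sum.cong refl) (simp only: conv, auto)
  finally show ?thesis by simp
qed

text \<open>The partial sums of these coefficients are
  \<open>pochhammer (1 - \<gamma>) n / fact n\<close>. Once n is at least \<gamma>, the factor
  \<open>n + 1 - \<gamma>\<close> is positive and no sign changes occur, so the absolute values
  telescope as well.\<close>

lemma pochhammer_neg_abs_sum_bounded:
  fixes \<gamma> :: real
  assumes "\<gamma> \<ge> 0"
  obtains C where "\<And>n. (\<Sum>j\<le>n. \<bar>pochhammer (- \<gamma>) j / fact j\<bar>) \<le> C"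
proof -
  let ?c = "\<lambda>j. \<bar>pochhammer (- \<gamma>) j / fact j\<bar>"
  define d where "d n = \<bar>pochhammer (1 - \<gamma>) n / fact n\<bar>" for n
  obtain J :: nat where J: "real J \<ge> \<gamma>" using real_arch_simple by blast
  have telescope: "?c (Suc n) = d n - d (Suc n)" if "n \<ge> J" for n
  proof -
    have n: "real n \<ge> \<gamma>" using J that by linarith
    have "?c (Suc n) = \<gamma> / (n + 1) * d n"
      using assms pochhammer_rec[of "- \<gamma>" n] by (simp add: d_def abs_mult abs_divide field_simps)
    moreover have "d (Suc n) = (n + 1 - \<gamma>) / (n + 1) * d n"
    proof -
      have "pochhammer (1 - \<gamma>) (Suc n) / fact (Suc n) = (n + 1 - \<gamma>) / (n + 1) * (pochhammer (1 - \<gamma>) n / fact n)"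
        by (simp add: pochhammer_Suc field_simps)
      then show ?thesis
        using n unfolding d_def by (simp only: abs_mult) (simp add: abs_of_nonneg)
    qed
    moreover have "\<gamma> / (n + 1) * d n = d n - (n + 1 - \<gamma>) / (n + 1) * d n"
      by (simp add: field_simps)
    ultimately show ?thesis by (simp only:)
  qed
  have "(\<Sum>j\<le>J + i. ?c j) + d (J + i) = (\<Sum>j\<le>J. ?c j) + d J" for i
  proof (induction i)
    case (Suc i)
    with telescope[of "J + i"] show ?case by (simp only: add_Suc_right sum.atMost_Suc)
  qed simp
  moreover have "d n \<ge> 0" for n by (simp add: d_def)
  ultimately have bound: "(\<Sum>j\<le>J + i. ?c j) \<le> (\<Sum>j\<le>J. ?c j) + d J" for i
    by (metis le_add_same_cancel1)
  show ?thesis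
  proof (rule that)
    fix n
    have "(\<Sum>j\<le>n. ?c j) \<le> (\<Sum>j\<le>J + n. ?c j)" by (intro sum_mono2) auto
    then show "(\<Sum>j\<le>n. ?c j) \<le> (\<Sum>j\<le>J. ?c j) + d J" using bound[of n] by linarith
  qed
qed

text \<open>By \<open>cesaro_sum_diff\<close> it suffices to bound increments of the sums of order
  \<alpha>. For each vector these sums form an almost orbit on a window around n, with size governed
  by \<open>kker (\<alpha> + 1)\<close> and defect by the smaller \<open>kker \<alpha>\<close>. All
  bounds are proportional to \<open>norm x\<close>, which yields an operator norm estimate.\<close>

lemma cesaro_sum_pred_smallo:
  fixes T :: "'a::cnormed_vector \<Rightarrow>\<^sub>L 'a"
  assumes \<alpha>: "\<alpha> \<ge> 1"
    and "clinear_op T" "cesaro_bounded \<alpha> T" "cspectrum T \<inter> sphere 0 1 \<subseteq> {1}"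
  shows "(\<lambda>n. norm (cesaro_sum (\<alpha> - 1) T n)) \<in> o(kker (\<alpha> + 1))"
proof (rule landau_o.smallI)
  fix \<epsilon> :: real assume \<epsilon>: "\<epsilon> > 0"
  let ?k = "kker (\<alpha> + 1)" and ?S = "cesaro_sum \<alpha> T"
  have kpos: "?k n > 0" "kker \<alpha> n > 0" for n using \<alpha> by (auto intro: kker_pos)
  have kmono: "?k m \<le> ?k n" "kker \<alpha> m \<le> kker \<alpha> n" if "m \<le> n" for m n
    using \<alpha> that by (auto intro!: monoD[OF mono_kker])
  from assms(3) obtain C0 where C0: "\<And>n. norm (cesaro_mean \<alpha> T n) \<le> C0"
    unfolding cesaro_bounded_def by blast
  define C where "C = max C0 1"
  have C: "C > 0" by (simp add: C_def)
  have S: "norm (?S n) \<le> C * ?k n" for n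
  proof -
    have "norm (?S n) / ?k n \<le> C"
      using C0[of n] kpos(1)[of n] by (simp add: cesaro_mean_def C_def)
    then show ?thesis using kpos(1)[of n] by (simp add: field_simps)
  qed
  have "\<epsilon> / (2 * C) > 0" using \<epsilon> C by simp
  then obtain M K where M: "M > 0" and K: "K \<ge> 0" and
    incr: "\<And>b B E. (\<And>j. j \<le> 2 * M \<Longrightarrow> norm (b j) \<le> B) \<Longrightarrow>
       (\<And>j. j < 2 * M \<Longrightarrow> norm (b (Suc j) - T (b j)) \<le> E) \<Longrightarrow>
       norm (b M - b (M - 1)) \<le> \<epsilon> / (2 * C) * B + K * E"
    using increment_of_almost_orbit[OF assms(2,4)] by metis
  have bound: "norm (?S (Suc n) - ?S n) \<le>
    \<epsilon> / 2 * ?k (n + (M + 1)) + K * kker \<alpha> (n + (M + 1))" if "n \<ge> M" for n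
  proof (rule norm_blinfun_bound)
    let ?N = "n + (M + 1)"
    show "0 \<le> \<epsilon> / 2 * ?k ?N + K * kker \<alpha> ?N"
      using \<epsilon> K kpos[of ?N] by (intro add_nonneg_nonneg mult_nonneg_nonneg) auto
    fix x
    \<comment> \<open>With this start, position \<open>M\<close> of the window is n + 1 and its last
      position \<open>2 * M\<close> is \<open>?N\<close>; by monotonicity the kernels at
      \<open>?N\<close> bound everything in between.\<close>
    define r where "r = n + 1 - M"
    have r: "r + 2 * M = ?N" "r + M = Suc n" "r + (M - 1) = n" using that M by (auto simp: r_def)
    have "norm (?S (r + M) x - ?S (r + (M - 1)) x) \<le>
      \<epsilon> / (2 * C) * (C * ?k ?N * norm x) + K * (kker \<alpha> ?N * norm x)"
    proof (rule incr)
      fix j assume j: "j \<le> 2 * M"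
      have "norm (?S (r + j) x) \<le> norm (?S (r + j)) * norm x" by (rule norm_blinfun)
      also have "\<dots> \<le> C * ?k ?N * norm x"
        using C r(1) j by (intro mult_right_mono order.trans[OF S] mult_left_mono kmono) auto
      finally show "norm (?S (r + j) x) \<le> C * ?k ?N * norm x" .
    next
      fix j assume j: "j < 2 * M"
      have "?S (r + Suc j) x - T (?S (r + j) x) = kker \<alpha> (Suc (r + j)) *\<^sub>R x"
        by (simp add: cesaro_sum_Suc blinfun.add_left blinfun.scaleR_left)
      then show "norm (?S (r + Suc j) x - T (?S (r + j) x)) \<le> kker \<alpha> ?N * norm x"
        using kpos(2)[of "Suc (r + j)"] r(1) j by (simp add: mult_right_mono kmono)
    qed
    then show "norm ((?S (Suc n) - ?S n) x) \<le> (\<epsilon> / 2 * ?k ?N + K * kker \<alpha> ?N) * norm x"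
      using C unfolding r by (simp add: blinfun.diff_left algebra_simps)
  qed
  \<comment> \<open>Relative to \<open>?k n\<close> the bound tends to \<epsilon>/2, so the strict
    gap to \<epsilon> absorbs both the defect and the shift.\<close>
  have "(\<lambda>n. (\<epsilon> / 2 + K * (\<alpha> / (\<alpha> + real (n + (M + 1))))) * (?k (n + (M + 1)) / ?k n)) \<longlonglongrightarrow> (\<epsilon> / 2 + K * 0) * 1"
  proof (intro tendsto_intros kker_shift_ratio_tendsto)
    show "(\<lambda>n. \<alpha> / (\<alpha> + real (n + (M + 1)))) \<longlonglongrightarrow> 0" by real_asymp
  qed (use \<alpha> in auto)
  then have "\<forall>\<^sub>F n in sequentially. (\<epsilon> / 2 + K * (\<alpha> / (\<alpha> + real (n + (M + 1))))) * (?k (n + (M + 1)) / ?k n) < \<epsilon>"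
    by (rule order_tendstoD) (use \<epsilon> in simp)
  then have "\<forall>\<^sub>F n in sequentially. norm (cesaro_sum (\<alpha> - 1) T (Suc n)) \<le> \<epsilon> * ?k (Suc n)"
    using eventually_ge_at_top[of M]
  proof eventually_elim
    case (elim n)
    let ?N = "n + (M + 1)"
    have "kker \<alpha> ?N = \<alpha> / (\<alpha> + real ?N) * ?k ?N"
      using \<alpha> by (simp add: kker_add_1)
    then have "norm (?S (Suc n) - ?S n) \<le> (\<epsilon> / 2 + K * (\<alpha> / (\<alpha> + real ?N))) * ?k ?N"
      using bound[OF elim(2)] by (simp add: algebra_simps)
    also have "\<dots> \<le> \<epsilon> * ?k n"
      using elim(1) kpos(1)[of n] by (simp add: field_simps)
    also have "\<dots> \<le> \<epsilon> * ?k (Suc n)" using \<epsilon> by (intro mult_left_mono kmono) auto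
    finally show ?case using \<alpha> by (simp add: cesaro_sum_diff)
  qed
  then have "\<forall>\<^sub>F n in sequentially. norm (cesaro_sum (\<alpha> - 1) T n) \<le> \<epsilon> * ?k n"
    by (subst (asm) eventually_sequentially_Suc)
  then show "\<forall>\<^sub>F n in sequentially. norm (norm (cesaro_sum (\<alpha> - 1) T n)) \<le> \<epsilon> * norm (?k n)"
    by eventually_elim (use kpos in \<open>simp add: less_imp_le\<close>)
qed

theorem theorem4p3:
  fixes T :: "'a::{cnormed_vector, banach} \<Rightarrow>\<^sub>L 'a" and \<alpha> :: real
  assumes "\<alpha> \<ge> 1"
    and "clinear_op T"
    and "cesaro_bounded \<alpha> T"
    and "cspectrum T \<inter> sphere 0 1 \<subseteq> {1}"
  shows "(\<lambda>n. norm (cesaro_mean (\<alpha> - 1) T n)) \<in> o(\<lambda>n. real n) \<and>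
         (\<lambda>n. norm (op_pow T n)) \<in> o(\<lambda>n. real n powr \<alpha>)"
proof
  let ?k = "kker (\<alpha> + 1)" and ?D = "cesaro_sum (\<alpha> - 1) T"
  have kpos: "?k n > 0" "kker \<alpha> n > 0" for n using assms(1) by (auto intro: kker_pos)
  note D = cesaro_sum_pred_smallo[OF assms]
  \<comment> \<open>The mean of order \<alpha> - 1 is normalised by \<open>kker \<alpha>\<close>,
    and the ratio of the two kernels is linear in n.\<close>
  have "(\<lambda>n. norm (?D n) / kker \<alpha> n) \<in> o(\<lambda>n. ?k n / kker \<alpha> n)"
    using D kpos(2) by (intro landau_o.small.divide_right) (auto intro!: always_eventually simp: less_imp_neq[symmetric])
  also have "(\<lambda>n. ?k n / kker \<alpha> n) = (\<lambda>n. (\<alpha> + real n) / \<alpha>)"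
    using assms(1) kpos(2) by (auto simp: kker_add_1 less_imp_neq[symmetric])
  also have "\<dots> \<in> O(\<lambda>n. real n)" using assms(1) by real_asymp
  finally show "(\<lambda>n. norm (cesaro_mean (\<alpha> - 1) T n)) \<in> o(\<lambda>n. real n)"
    using kpos(2) by (simp add: cesaro_mean_def abs_of_pos)
  from assms(1) obtain C0 where C0: "\<And>n. (\<Sum>j\<le>n. \<bar>pochhammer (- (\<alpha> - 1)) j / fact j\<bar>) \<le> C0"
    using pochhammer_neg_abs_sum_bounded[of "\<alpha> - 1"] by auto
  define C where "C = max C0 1"
  have C: "C > 0" by (simp add: C_def)
  have "(\<lambda>n. norm (op_pow T n)) \<in> o(?k)"
  proof (rule landau_o.smallI)
    fix \<epsilon> :: real assume \<epsilon>: "\<epsilon> > 0"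
    define \<delta> where "\<delta> = \<epsilon> / C"
    have \<delta>: "\<delta> > 0" using \<epsilon> C by (simp add: \<delta>_def)
    from landau_o.smallD[OF D \<delta>] obtain N where N: "\<And>n. n \<ge> N \<Longrightarrow> norm (?D n) \<le> \<delta> * ?k n"
      using kpos(1) by (auto simp: eventually_sequentially abs_of_pos)
    \<comment> \<open>\<open>Q\<close> bounds the early sums, to which the little-o estimate does
      not yet apply; the growth of \<open>?k\<close> overtakes it.\<close>
    define Q where "Q = (\<Sum>m<N. norm (?D m))"
    have "\<forall>\<^sub>F n in sequentially. ?k n \<ge> Q / \<delta>"
      using filterlim_kker[OF assms(1)] by (simp add: filterlim_at_top)
    then show "\<forall>\<^sub>F n in sequentially. norm (norm (op_pow T n)) \<le> \<epsilon> * norm (?k n)"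
    proof eventually_elim
      case (elim n)
      have D_le: "norm (?D m) \<le> \<delta> * ?k n" if "m \<le> n" for m
      proof (cases "m < N")
        case True
        then have "norm (?D m) \<le> Q" unfolding Q_def by (intro member_le_sum) auto
        then show ?thesis using elim \<delta> by (simp add: field_simps)
      next
        case False
        have "?k m \<le> ?k n" using assms(1) that by (intro monoD[OF mono_kker]) auto
        then have "\<delta> * ?k m \<le> \<delta> * ?k n" using \<delta> by simp
        then show ?thesis using N[of m] False by linarith
      qed
      \<comment> \<open>All sums up to index n obey the same bound \<open>\<delta> * ?k n\<close>,
        so only the absolute sum of the coefficients matters; \<delta> was chosen to cancel its
        bound \<open>C\<close>.\<close>
      have "norm (op_pow T n) \<le> (\<Sum>j\<le>n. \<bar>pochhammer (- (\<alpha> - 1)) j / fact j\<bar> * (\<delta> * ?k n))"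
        unfolding op_pow_eq_sum_cesaro_sum[of "\<alpha> - 1" T n, simplified diff_ge_0_iff_ge, OF assms(1)]
        by (intro sum_norm_le) (simp only: norm_scaleR, intro mult_left_mono D_le, simp_all)
      also have "\<dots> = (\<Sum>j\<le>n. \<bar>pochhammer (- (\<alpha> - 1)) j / fact j\<bar>) * (\<delta> * ?k n)"
        by (simp only: sum_distrib_right)
      also have "\<dots> \<le> C * (\<delta> * ?k n)"
        using C0[of n] \<delta> kpos(1)[of n] by (intro mult_right_mono) (auto simp: C_def)
      also have "\<dots> = \<epsilon> * ?k n" using C by (simp add: \<delta>_def)
      finally show ?case using kpos(1)[of n] by simp
    qed
  qed
  also have "?k \<in> O(\<lambda>n. real n powr \<alpha>)" using assms(1) by (intro kker_bigo_powr) simp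
  finally show "(\<lambda>n. norm (op_pow T n)) \<in> o(\<lambda>n. real n powr \<alpha>)" .
qed

end
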